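(* $\mathrm{SYM}\circ\mathrm{MAJ}\subseteq k\mathrm{STAT}_{\mathrm{poly}}$.
   Context: All classes are classes of families of Boolean functions on $\{0,1\}^n$; "polynomial" means polynomial in $n$. A majority gate is a threshold gate $\mathbf{1}[\langle\mathbf{w},\mathbf{z}\rangle\ge\theta]$ with integer weights and threshold polynomially bounded in absolute value. $\mathrm{SYM}\circ\mathrm{MAJ}$ is the class of functions $f(\mathbf{x})=g(h_1(\mathbf{x}),\dots,h_s(\mathbf{x}))$ where $s$ is polynomial, each $h_i$ is a majority gate whose inputs are variables, negated variables, or constants, and $g:\{0,1\}^s\to\{0,1\}$ is symmetric (depends only on the Hamming weight of its input). For a vector $\mathbf{z}$, $\mathbf{z}_{(k)}$ denotes its $k$-th smallest entry. $k\mathrm{STAT}_{\mathrm{poly}}$ is the class of functions $f$ for which there exist linear forms (affine functions) $L_1,\dots,L_{\ell_1},R_1,\dots,R_{\ell_2}$ with integer coefficients bounded in absolute value by a polynomial in $n$, $\ell_1+\ell_2$ polynomial in $n$, and integers $k_l,k_r$, such that $f(\mathbf{x})=1\iff(L_1(\mathbf{x}),\dots,L_{\ell_1}(\mathbf{x}))_{(k_l)}<(R_1(\mathbf{x}),\dots,R_{\ell_2}(\mathbf{x}))_{(k_r)}$. *)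

theory Defs
  imports "HOL-Computational_Algebra.Polynomial"
begin

text \<open>
  A point of \<open>{0,1}\<^sup>n\<close> is a Boolean list of length \<open>n\<close>. The \<open>n\<close>-th member of a family of Boolean
  functions is only ever evaluated on lists of length \<open>n\<close>; its values elsewhere are irrelevant.
\<close>

type_synonym bool_family = "nat \<Rightarrow> bool list \<Rightarrow> bool"

text \<open>
  In both classes a single bound \<open>B\<close> limits all size and magnitude parameters for a given \<open>n\<close>; it is
  the value at \<open>n\<close> of one polynomial with natural coefficients. Separate polynomials for the
  individual parameters would give the same classes, since the sum of such polynomials bounds each
  of them.
\<close>


subsection \<open>Symmetric functions of majority gates\<close>

definition threshold_gate :: "int list \<Rightarrow> int \<Rightarrow> bool list \<Rightarrow> bool" where
  "threshold_gate w \<theta> z \<longleftrightarrow> (\<Sum>i<length z. w ! i * of_bool (z ! i)) \<ge> \<theta>"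

datatype gate_input = Var nat | Neg nat | Const bool

primrec input_ok :: "nat \<Rightarrow> gate_input \<Rightarrow> bool" where
  "input_ok n (Var i) \<longleftrightarrow> i < n"
| "input_ok n (Neg i) \<longleftrightarrow> i < n"
| "input_ok n (Const b) \<longleftrightarrow> True"

primrec input_val :: "bool list \<Rightarrow> gate_input \<Rightarrow> bool" where
  "input_val x (Var i) = x ! i"
| "input_val x (Neg i) = (\<not> x ! i)"
| "input_val x (Const b) = b"

text \<open>
  The same variable or constant may feed a gate several times, so the fan-in has to be bounded as
  well: repetition would otherwise yield arbitrarily large effective weights.
\<close>

definition majority_gate :: "nat \<Rightarrow> nat \<Rightarrow> (bool list \<Rightarrow> bool) \<Rightarrow> bool" where
  "majority_gate n B h \<longleftrightarrow>
     (\<exists>(w :: int list) (\<theta> :: int) (u :: gate_input list).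
        length w = length u \<and> length u \<le> B \<and>
        (\<forall>c \<in> set w. \<bar>c\<bar> \<le> int B) \<and> \<bar>\<theta>\<bar> \<le> int B \<and>
        (\<forall>v \<in> set u. input_ok n v) \<and>
        (\<forall>x. length x = n \<longrightarrow> h x = threshold_gate w \<theta> (map (input_val x) u)))"

definition hamming_weight :: "bool list \<Rightarrow> nat" where
  "hamming_weight z = count_list z True"

definition symmetric_fun :: "nat \<Rightarrow> (bool list \<Rightarrow> bool) \<Rightarrow> bool" where
  "symmetric_fun s g \<longleftrightarrow>
     (\<forall>y z. length y = s \<and> length z = s \<and> hamming_weight y = hamming_weight z \<longrightarrow> g y = g z)"

definition sym_maj_circuit :: "nat \<Rightarrow> nat \<Rightarrow> (bool list \<Rightarrow> bool) \<Rightarrow> bool" where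
  "sym_maj_circuit n B f \<longleftrightarrow>
     (\<exists>(hs :: (bool list \<Rightarrow> bool) list) (g :: bool list \<Rightarrow> bool).
        length hs \<le> B \<and>
        (\<forall>h \<in> set hs. majority_gate n B h) \<and>
        symmetric_fun (length hs) g \<and>
        (\<forall>x. length x = n \<longrightarrow> f x = g (map (\<lambda>h. h x) hs)))"

definition SYM_MAJ :: "bool_family set" where
  "SYM_MAJ = {F. \<exists>p :: nat poly. \<forall>n. sym_maj_circuit n (poly p n) (F n)}"


subsection \<open>Comparisons of order statistics of linear forms\<close>

text \<open>The \<open>k\<close>-th smallest entry, with multiplicity; \<open>k\<close> counts from 1 and must not exceed the length.\<close>

definition kth_smallest :: "nat \<Rightarrow> int list \<Rightarrow> int" where
  "kth_smallest k z = sort z ! (k - 1)"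

definition linear_form :: "nat \<Rightarrow> nat \<Rightarrow> (bool list \<Rightarrow> int) \<Rightarrow> bool" where
  "linear_form n B L \<longleftrightarrow>
     (\<exists>(a :: int list) (b :: int).
        length a = n \<and> (\<forall>c \<in> set a. \<bar>c\<bar> \<le> int B) \<and> \<bar>b\<bar> \<le> int B \<and>
        (\<forall>x. length x = n \<longrightarrow> L x = (\<Sum>i<n. a ! i * of_bool (x ! i)) + b))"

definition kstat_representation :: "nat \<Rightarrow> nat \<Rightarrow> (bool list \<Rightarrow> bool) \<Rightarrow> bool" where
  "kstat_representation n B f \<longleftrightarrow>
     (\<exists>(Ls :: (bool list \<Rightarrow> int) list) (Rs :: (bool list \<Rightarrow> int) list) (kl :: nat) (kr :: nat).
        length Ls + length Rs \<le> B \<and>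
        (\<forall>L \<in> set Ls. linear_form n B L) \<and>
        (\<forall>R \<in> set Rs. linear_form n B R) \<and>
        1 \<le> kl \<and> kl \<le> length Ls \<and> 1 \<le> kr \<and> kr \<le> length Rs \<and>
        (\<forall>x. length x = n \<longrightarrow>
           (f x \<longleftrightarrow> kth_smallest kl (map (\<lambda>L. L x) Ls) < kth_smallest kr (map (\<lambda>R. R x) Rs))))"

definition kSTAT_poly :: "bool_family set" where
  "kSTAT_poly = {F. \<exists>p :: nat poly. \<forall>n. kstat_representation n (poly p n) (F n)}"

end

theory Submission
  imports Defs
begin

text \<open>
  A gate \<open>A\<^sub>i(x) \<ge> 0\<close> turns into the form \<open>M (2 A\<^sub>i(x) + 1)\<close>, which is at least \<open>M\<close> if
  the gate accepts and at most \<open>-M\<close> otherwise. Add \<open>s + 1\<close> constants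
  \<open>c\<^sub>0 \<le> \<dots> \<le> c\<^sub>s\<close> from \<open>[-M, M]\<close> to these \<open>s\<close> forms: if \<open>m\<close> gates accept,
  exactly \<open>s - m\<close> forms lie below the constants, so the \<open>(s + 1)\<close>-st smallest entry is
  \<open>c\<^sub>m\<close>. Comparing \<open>c\<^sub>m = 2m\<close> on the left with \<open>d\<^sub>m = 2m + [m \<in> S]\<close> on the
  right decides \<open>m \<in> S\<close> for an arbitrary set \<open>S\<close>.
\<close>

section \<open>Order statistics of a list split by a block of constants\<close>

lemma kth_smallest_separated:
  assumes "sorted cs" and len: "length cs = length vs + 1"
    and hi: "\<And>v c. v \<in> set vs \<Longrightarrow> P v \<Longrightarrow> c \<in> set cs \<Longrightarrow> c \<le> v"
    and lo: "\<And>v c. v \<in> set vs \<Longrightarrow> \<not> P v \<Longrightarrow> c \<in> set cs \<Longrightarrow> v \<le> c"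
  shows "kth_smallest (length vs + 1) (vs @ cs) = cs ! length (filter P vs)"
proof -
  define low where "low = sort (filter (\<lambda>v. \<not> P v) vs)"
  define high where "high = sort (filter P vs)"
  \<comment> \<open>Some constant exists and serves as a pivot: a value violating \<open>P\<close>
    is at most \<open>c\<close>, which is at most any value satisfying \<open>P\<close>.\<close>
  from len obtain c where c: "c \<in> set cs"
    by (cases cs) auto
  have "v \<le> u" if "v \<in> set vs" "\<not> P v" "u \<in> set vs" "P u" for u v
    using lo[OF that(1,2) c] hi[OF that(3,4) c] by simp
  then have "sorted (low @ cs @ high)"
    using \<open>sorted cs\<close> hi lo unfolding low_def high_def sorted_append
    by auto
  moreover have "mset (low @ cs @ high) = mset (vs @ cs)"
    unfolding low_def high_def by (simp add: mset_filter)
  ultimately have sort: "sort (vs @ cs) = low @ cs @ high"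
    by (metis properties_for_sort)
  \<comment> \<open>Ranks count from 1, so rank \<open>length vs + 1\<close> is index
    \<open>length vs\<close> after sorting. Skipping \<open>low\<close> leaves an index into
    \<open>cs\<close>, namely the number of values satisfying \<open>P\<close>.\<close>
  have "length low \<le> length vs" "length vs - length low = length (filter P vs)"
    unfolding low_def using sum_length_filter_compl[of P vs] by simp_all
  then show ?thesis
    using len le_imp_less_Suc[OF length_filter_le[of P vs]] by (simp add: kth_smallest_def sort nth_append)
qed

section \<open>Closure of linear forms, with explicit coefficient bounds\<close>

lemma linear_form_mono: "linear_form n B L \<Longrightarrow> B \<le> C \<Longrightarrow> linear_form n C L"
  unfolding linear_form_def
  by (elim exE, rule exI, rule exI) (auto intro: order_trans[OF _ iffD2[OF of_nat_le_iff]])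

lemma linear_form_const:
  assumes "\<bar>c\<bar> \<le> int B"
  shows "linear_form n B (\<lambda>x. c)"
  unfolding linear_form_def
  by (rule exI[of _ "replicate n 0"], rule exI[of _ c]) (use assms in auto)

lemma linear_form_var:
  assumes "i < n"
  shows "linear_form n 1 (\<lambda>x. of_bool (x ! i))"
proof -
  have "(\<Sum>j<n. (replicate n 0)[i := 1] ! j * of_bool (x ! j)) = (of_bool (x ! i) :: int)" for x
  proof -
    have "(\<Sum>j<n. (replicate n 0)[i := 1] ! j * of_bool (x ! j))
        = (\<Sum>j<n. if i = j then of_bool (x ! j) else (0 :: int))"
      by (rule sum.cong) (auto simp: nth_list_update)
    with assms show ?thesis by simp
  qed
  moreover have "\<forall>c \<in> set ((replicate n 0)[i := 1]). \<bar>c\<bar> \<le> (1 :: int)"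
    using set_update_subset_insert[of "replicate n 0" i "1 :: int"] by fastforce
  ultimately show ?thesis
    unfolding linear_form_def
    by (intro exI[of _ "(replicate n 0)[i := 1]"] exI[of _ 0]) auto
qed

lemma linear_form_add:
  assumes "linear_form n B L" "linear_form n C R"
  shows "linear_form n (B + C) (\<lambda>x. L x + R x)"
proof -
  from assms(1) obtain a b where a: "length a = n" "\<forall>c \<in> set a. \<bar>c\<bar> \<le> int B" "\<bar>b\<bar> \<le> int B"
    "\<And>x. length x = n \<Longrightarrow> L x = (\<Sum>i<n. a ! i * of_bool (x ! i)) + b"
    unfolding linear_form_def by blast
  from assms(2) obtain a' b' where a': "length a' = n" "\<forall>c \<in> set a'. \<bar>c\<bar> \<le> int C" "\<bar>b'\<bar> \<le> int C"
    "\<And>x. length x = n \<Longrightarrow> R x = (\<Sum>i<n. a' ! i * of_bool (x ! i)) + b'"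
    unfolding linear_form_def by blast
  define e where "e = map2 (+) a a'"
  have e: "length e = n" "\<And>i. i < n \<Longrightarrow> e ! i = a ! i + a' ! i"
    using a(1) a'(1) by (simp_all add: e_def)
  have "\<bar>c\<bar> \<le> int (B + C)" if "c \<in> set e" for c
  proof -
    from that obtain i where i: "i < n" "c = a ! i + a' ! i"
      using e by (metis in_set_conv_nth)
    then have "\<bar>a ! i\<bar> \<le> int B" "\<bar>a' ! i\<bar> \<le> int C"
      using a a' by simp_all
    with i show ?thesis by simp
  qed
  moreover have "L x + R x = (\<Sum>i<n. e ! i * of_bool (x ! i)) + (b + b')" if "length x = n" for x
    using a(4)[OF that] a'(4)[OF that] e(2) by (simp add: distrib_right sum.distrib)
  moreover have "\<bar>b + b'\<bar> \<le> int (B + C)"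
    using a(3) a'(3) by simp
  ultimately show ?thesis
    unfolding linear_form_def using e(1) by blast
qed

lemma linear_form_scale:
  assumes "linear_form n B L" "\<bar>k\<bar> \<le> int C"
  shows "linear_form n (C * B) (\<lambda>x. k * L x)"
proof -
  from assms(1) obtain a b where a: "length a = n" "\<forall>c \<in> set a. \<bar>c\<bar> \<le> int B" "\<bar>b\<bar> \<le> int B"
    "\<And>x. length x = n \<Longrightarrow> L x = (\<Sum>i<n. a ! i * of_bool (x ! i)) + b"
    unfolding linear_form_def by blast
  have bound: "\<bar>k * c\<bar> \<le> int (C * B)" if "\<bar>c\<bar> \<le> int B" for c
    using assms(2) that by (simp add: abs_mult mult_mono)
  have "k * L x = (\<Sum>i<n. map ((*) k) a ! i * of_bool (x ! i)) + k * b" if "length x = n" for x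
    unfolding a(4)[OF that] distrib_left sum_distrib_left using a(1)
    by (intro arg_cong2[of _ _ _ _ "(+)"] sum.cong) (simp_all add: mult.assoc)
  then show ?thesis
    unfolding linear_form_def using a bound
    by (intro exI[of _ "map ((*) k) a"] exI[of _ "k * b"]) auto
qed

lemma linear_form_sum:
  assumes "\<And>j. j < m \<Longrightarrow> linear_form n B (L j)"
  shows "linear_form n (m * B) (\<lambda>x. \<Sum>j<m. L j x)"
  using assms
proof (induction m)
  case 0
  show ?case using linear_form_const[of 0 0 n] by simp
next
  case (Suc m)
  then have "linear_form n (m * B + B) (\<lambda>x. (\<Sum>j<m. L j x) + L m x)"
    by (intro linear_form_add) auto
  then show ?case by (simp add: add.commute)
qed

text \<open>The bound 2 comes from negation, assembled as \<open>1 + (- 1) * x ! i\<close>: addition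
  of forms adds their bounds.\<close>

lemma linear_form_input:
  assumes "input_ok n v"
  shows "linear_form n 2 (\<lambda>x. of_bool (input_val x v))"
proof (cases v)
  case (Var i)
  with assms show ?thesis
    using linear_form_mono[OF linear_form_var, of i n 2] by simp
next
  case (Neg i)
  with assms have "linear_form n (1 + 1 * 1) (\<lambda>x. 1 + (- 1) * of_bool (x ! i))"
    by (intro linear_form_add linear_form_scale linear_form_const linear_form_var) auto
  with Neg show ?thesis by (simp add: of_bool_not_iff numeral_2_eq_2)
next
  case (Const b)
  then show ?thesis by (simp add: linear_form_const)
qed

section \<open>Majority gates as linear forms\<close>

lemma majority_gate_linear_form:
  assumes "majority_gate n B h"
  obtains A where "linear_form n (2 * B * B + B) A"
    and "\<And>x. length x = n \<Longrightarrow> h x \<longleftrightarrow> A x \<ge> 0"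
proof -
  from assms obtain w \<theta> u where w: "length w = length u" "length u \<le> B"
    "\<forall>c \<in> set w. \<bar>c\<bar> \<le> int B" "\<bar>\<theta>\<bar> \<le> int B" "\<forall>v \<in> set u. input_ok n v"
    and h: "\<And>x. length x = n \<Longrightarrow> h x = threshold_gate w \<theta> (map (input_val x) u)"
    unfolding majority_gate_def by blast
  define A where "A x = (\<Sum>j<length u. w ! j * of_bool (input_val x (u ! j))) + (- \<theta>)" for x
  \<comment> \<open>Each input form has bound 2 and is scaled by a weight of size at most
    \<open>B\<close>. Adding the bounds over all inputs also covers a variable that is fed in
    repeatedly; the last \<open>B\<close> pays for the threshold.\<close>
  have "linear_form n (length u * (B * 2) + B) A"
    unfolding A_def using w
    by (intro linear_form_add linear_form_sum linear_form_scale linear_form_input linear_form_const) auto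
  then have "linear_form n (2 * B * B + B) A"
    by (rule linear_form_mono) (use w(2) in simp)
  moreover have "h x \<longleftrightarrow> A x \<ge> 0" if "length x = n" for x
    using h[OF that] by (auto simp: A_def threshold_gate_def)
  ultimately show ?thesis by (rule that)
qed

text \<open>The first factor is the scale \<open>M = 2 * B + 2\<close>; the second bounds the
  coefficients of \<open>2 * A + 1\<close>, where \<open>A\<close> is the form of a gate.\<close>

definition kstat_bound :: "nat \<Rightarrow> nat" where
  "kstat_bound B = (2 * B + 2) * (2 * (2 * B * B + B) + 1)"

text \<open>Since \<open>A x\<close> is an integer, rejection means \<open>A x \<le> - 1\<close>, so
  \<open>2 * A x + 1\<close> is at least 1 or at most -1. The scale is chosen to exceed every
  constant used later, the largest being at most \<open>2 * B + 1\<close>.\<close>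

lemma majority_gate_separating_form:
  assumes "majority_gate n B h"
  obtains L where "linear_form n (kstat_bound B) L"
    and "\<And>x. length x = n \<Longrightarrow> h x \<Longrightarrow> L x \<ge> 2 * int B + 2"
    and "\<And>x. length x = n \<Longrightarrow> \<not> h x \<Longrightarrow> L x \<le> - (2 * int B + 2)"
proof -
  from assms obtain A where A: "linear_form n (2 * B * B + B) A"
    and h: "\<And>x. length x = n \<Longrightarrow> h x \<longleftrightarrow> A x \<ge> 0"
    using majority_gate_linear_form by blast
  define M where "M = 2 * int B + 2"
  have "linear_form n (kstat_bound B) (\<lambda>x. M * (2 * A x + 1))"
    unfolding kstat_bound_def M_def
    by (intro linear_form_scale linear_form_add linear_form_const A) auto
  moreover have "M * (2 * A x + 1) \<ge> M" if "length x = n" "h x" for x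
    using h that mult_left_mono[of 1 "2 * A x + 1" M] by (simp add: M_def)
  moreover have "M * (2 * A x + 1) \<le> - M" if "length x = n" "\<not> h x" for x
    using h that mult_left_mono[of "2 * A x + 1" "- 1" M] by (simp add: M_def)
  ultimately show ?thesis
    using that unfolding M_def by blast
qed

section \<open>From circuits to comparisons of order statistics\<close>

lemma kstat_representation_if_sym_maj_circuit:
  assumes "sym_maj_circuit n B f"
  shows "kstat_representation n (kstat_bound B + 4 * B + 2) f"
proof -
  from assms obtain hs g where hs: "length hs \<le> B" "\<forall>h \<in> set hs. majority_gate n B h"
    and g: "symmetric_fun (length hs) g"
    and f: "\<And>x. length x = n \<Longrightarrow> f x = g (map (\<lambda>h. h x) hs)"
    unfolding sym_maj_circuit_def by blast
  define s where "s = length hs"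
  \<comment> \<open>The set \<open>S\<close> of accepted weights, read off by evaluating
    \<open>g\<close> at one representative of each weight.\<close>
  define accepts where "accepts m \<longleftrightarrow> g (replicate m True @ replicate (s - m) False)" for m
  have "\<exists>L. linear_form n (kstat_bound B) L \<and>
      (\<forall>x. length x = n \<longrightarrow> (if h x then L x \<ge> 2 * int B + 2 else L x \<le> - (2 * int B + 2)))"
    if "h \<in> set hs" for h
    using majority_gate_separating_form[of n B h] hs(2) that by metis
  then obtain L where L: "\<And>h. h \<in> set hs \<Longrightarrow> linear_form n (kstat_bound B) (L h)"
    and L_sep: "\<And>h x. h \<in> set hs \<Longrightarrow> length x = n \<Longrightarrow>
      if h x then L h x \<ge> 2 * int B + 2 else L h x \<le> - (2 * int B + 2)"
    by metis
  \<comment> \<open>Both sides of the comparison use the same gate forms and differ only in the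
    constants \<open>c\<close>.\<close>
  define forms where "forms c = map L hs @ map (\<lambda>m x. c m) [0..<s + 1]" for c :: "nat \<Rightarrow> int"
  define weight where "weight x = length (filter (\<lambda>h. h x) hs)" for x
  have weight_le: "weight x \<le> s" for x
    by (simp add: weight_def s_def)

  have stat: "kth_smallest (s + 1) (map (\<lambda>L. L x) (forms c)) = c (weight x)"
    if c: "\<And>m. m \<le> s \<Longrightarrow> 0 \<le> c m \<and> c m \<le> 2 * int B + 2" "\<And>i j. i \<le> j \<Longrightarrow> c i \<le> c j"
      and x: "length x = n" for c x
  proof -
    let ?vs = "map (\<lambda>h. L h x) hs" and ?cs = "map c [0..<s + 1]"
    have eq: "map (\<lambda>L. L x) (forms c) = ?vs @ ?cs"
      by (simp add: forms_def o_def)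
    \<comment> \<open>The predicate in \<open>kth_smallest_separated\<close> sees values rather than
      gates, so acceptance is recovered from the sign.\<close>
    have "L h x \<ge> 0 \<longleftrightarrow> h x" if "h \<in> set hs" for h
      using L_sep[OF that x] by (auto split: if_splits)
    then have "length (filter (\<lambda>v. v \<ge> 0) ?vs) = weight x"
      by (simp add: weight_def filter_map o_def cong: filter_cong)
    moreover have "kth_smallest (length ?vs + 1) (?vs @ ?cs)
        = ?cs ! length (filter (\<lambda>v. v \<ge> 0) ?vs)"
    proof (rule kth_smallest_separated)
      show "sorted ?cs"
        using c(2) by (auto simp: sorted_iff_nth_mono nth_append simp del: upt_Suc)
      show "length ?cs = length ?vs + 1"
        by (simp add: s_def)
    next
      fix v k assume v: "v \<in> set ?vs" and k: "k \<in> set ?cs"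
      from k have k: "0 \<le> k" "k \<le> 2 * int B + 2"
        using c(1) by (auto simp: less_Suc_eq_le)
      from v obtain h where h: "h \<in> set hs" "v = L h x" by auto
      show "k \<le> v" if "0 \<le> v"
        using L_sep[OF h(1) x] h(2) k that by (auto split: if_splits)
      show "v \<le> k" if "\<not> 0 \<le> v"
        using k that by simp
    qed
    ultimately show ?thesis
      using weight_le[of x] by (simp add: eq s_def[symmetric] nth_append del: upt_Suc)
  qed

  have forms: "linear_form n (kstat_bound B + 4 * B + 2) F"
    if "F \<in> set (forms c)" and "\<And>m. m \<le> s \<Longrightarrow> 0 \<le> c m \<and> c m \<le> 2 * int B + 2" for F c
  proof -
    from that(1) have "(\<exists>h \<in> set hs. F = L h) \<or> (\<exists>m \<le> s. F = (\<lambda>x. c m))"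
      unfolding forms_def by (auto simp: less_Suc_eq_le simp del: upt_Suc)
    then show ?thesis
    proof (elim disjE bexE exE conjE)
      fix h assume "h \<in> set hs" "F = L h"
      then show ?thesis using linear_form_mono[OF L] by simp
    next
      fix m assume "m \<le> s" "F = (\<lambda>x. c m)"
      then show ?thesis using that(2)[of m] by (auto intro!: linear_form_const)
    qed
  qed

  \<comment> \<open>Spacing 2 leaves room for the accepting bit without breaking monotonicity: for
    \<open>i < j\<close>, \<open>d i \<le> 2 * i + 1 < 2 * j \<le> d j\<close>. At equal index,
    \<open>c m < d m\<close> holds exactly if \<open>accepts m\<close>.\<close>
  define c where "c m = 2 * int m" for m
  define d where "d m = 2 * int m + of_bool (accepts m)" for m
  have c_bounds: "0 \<le> c m \<and> c m \<le> 2 * int B + 2"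
    and d_bounds: "0 \<le> d m \<and> d m \<le> 2 * int B + 2" if "m \<le> s" for m
    using that hs(1) by (auto simp: c_def d_def s_def)
  have c_mono: "c i \<le> c j" and d_mono: "d i \<le> d j" if "i \<le> j" for i j
    using that by (cases "i = j"; auto simp: c_def d_def of_bool_def)+

  have "f x \<longleftrightarrow> accepts (weight x)" if "length x = n" for x
  proof -
    let ?y = "map (\<lambda>h. h x) hs"
      and ?z = "replicate (weight x) True @ replicate (s - weight x) False"
    have "hamming_weight ?y = weight x"
      by (simp add: hamming_weight_def weight_def count_list_eq_length_filter filter_map o_def)
    moreover have "hamming_weight ?z = weight x"
      by (simp add: hamming_weight_def count_list_eq_length_filter)
    ultimately have "g ?y = g ?z"
      using g weight_le[of x] unfolding symmetric_fun_def s_def[symmetric]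
      by (simp add: s_def)
    then show ?thesis
      using f[OF that] by (simp add: accepts_def)
  qed
  then have "f x \<longleftrightarrow> kth_smallest (s + 1) (map (\<lambda>L. L x) (forms c))
      < kth_smallest (s + 1) (map (\<lambda>R. R x) (forms d))" if "length x = n" for x
    using that stat[of c, OF c_bounds c_mono that] stat[of d, OF d_bounds d_mono that]
    by (simp add: c_def[of "weight x"] d_def[of "weight x"])
  moreover have len: "length (forms e) = 2 * s + 1" for e
    by (simp add: forms_def s_def)
  \<comment> \<open>The two lists have \<open>2 * (2 * s + 1) \<le> 4 * B + 2\<close> forms in all,
    which explains the summand \<open>4 * B + 2\<close>; it also covers the constants.\<close>
  moreover have "length (forms c) + length (forms d) \<le> kstat_bound B + 4 * B + 2"
    using hs(1) by (simp add: len s_def)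
  ultimately show ?thesis
    unfolding kstat_representation_def
    using forms[of _ c, OF _ c_bounds] forms[of _ d, OF _ d_bounds]
    by (intro exI[of _ "forms c"] exI[of _ "forms d"] exI[of _ "s + 1"]) auto
qed

theorem theorem6: "SYM_MAJ \<subseteq> kSTAT_poly"
proof
  fix F assume "F \<in> SYM_MAJ"
  then obtain p :: "nat poly" where p: "\<And>n. sym_maj_circuit n (poly p n) (F n)"
    unfolding SYM_MAJ_def by blast
  \<comment> \<open>This is the bound of the previous lemma with \<open>p\<close> substituted for
    \<open>B\<close>; as that bound is a polynomial expression in \<open>B\<close>, the result is
    again a polynomial.\<close>
  define q where
    "q = (2 * p + 2) * (2 * (2 * p * p + p) + 1) + 4 * p + 2"
  have "poly q n = kstat_bound (poly p n) + 4 * poly p n + 2" for n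
    by (simp add: q_def kstat_bound_def)
  with p have "kstat_representation n (poly q n) (F n)" for n
    by (metis kstat_representation_if_sym_maj_circuit)
  then show "F \<in> kSTAT_poly"
    unfolding kSTAT_poly_def by blast
qed

end
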